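(* Let $A(N)$ denote the number of generalised Petersen graphs $P(n,k)$, up to isomorphism, that have $n \leq N$, and let $B(N)$ denote the number of those (up to isomorphism) that are also Cayley graphs. Then $$\lim_{N \rightarrow \infty} \frac{B(N)}{A(N)} = 0.$$
   Context: For positive integers $n \geq 3$ and $k \leq n/2$, the generalised Petersen graph $P(n,k)$ is the graph with vertex set $\{a_i, b_i : 0 \leq i \leq n-1\}$ (so $2n$ vertices) and edges $a_i a_{i+1}$, $a_i b_i$, $b_i b_{i+k}$ for $0 \leq i \leq n-1$, with subscripts read modulo $n$. When $k=n/2$, the edges $b_ib_{i+k}$ and $b_{i+k}b_{i+2k}=b_{i+k}b_i$ are counted separately, so that $b_i$ and $b_{i+k}$ are joined by a double edge. With this convention $P(n,k)$ is always connected and cubic ($3$-regular). A graph is a Cayley graph if it is isomorphic to the (simple, undirected) graph $X(G,S)$ with vertex set a group $G$ and edges $\{g,gs\}$ for $g \in G$, $s \in S$, for some group $G$ and some symmetric subset $S=S^{-1}$ of $G$ with $1 \notin S$. *)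

theory Defs
  imports Complex_Main "HOL-Algebra.Group"
begin

text \<open>Undirected multigraphs are given by incidence: each edge has a set of end vertices, and
  distinct edges may have the same ends.\<close>

record ('v, 'e) multigraph =
  verts :: "'v set"
  edges :: "'e set"
  ends :: "'e \<Rightarrow> 'v set"

definition multigraph_iso :: "('v, 'e) multigraph \<Rightarrow> ('w, 'd) multigraph \<Rightarrow> bool" where
  "multigraph_iso X Y \<longleftrightarrow>
     (\<exists>f \<phi>. bij_betw f (verts X) (verts Y) \<and> bij_betw \<phi> (edges X) (edges Y) \<and>
        (\<forall>e\<in>edges X. ends Y (\<phi> e) = f ` ends X e))"

datatype gp_vertex = A_vertex nat | B_vertex nat

datatype gp_edge = Outer nat | Spoke nat | Inner nat

fun gp_ends :: "nat \<Rightarrow> nat \<Rightarrow> gp_edge \<Rightarrow> gp_vertex set" where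
  "gp_ends n k (Outer i) = {A_vertex i, A_vertex ((i + 1) mod n)}"
| "gp_ends n k (Spoke i) = {A_vertex i, B_vertex i}"
| "gp_ends n k (Inner i) = {B_vertex i, B_vertex ((i + k) mod n)}"

text \<open>The inner edges are indexed by \<open>i < n\<close>, so for \<open>2 * k = n\<close> the edges \<open>Inner i\<close> and
  \<open>Inner (i + k)\<close> are distinct and form a double edge.\<close>

definition gen_petersen :: "nat \<Rightarrow> nat \<Rightarrow> (gp_vertex, gp_edge) multigraph" where
  "gen_petersen n k =
     \<lparr>verts = A_vertex ` {0..<n} \<union> B_vertex ` {0..<n},
      edges = Outer ` {0..<n} \<union> Spoke ` {0..<n} \<union> Inner ` {0..<n},
      ends = gp_ends n k\<rparr>"

definition cayley_graph :: "('g, 'm) monoid_scheme \<Rightarrow> 'g set \<Rightarrow> ('g, 'g set) multigraph" where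
  "cayley_graph G S =
     \<lparr>verts = carrier G,
      edges = {{g, g \<otimes>\<^bsub>G\<^esub> s} | g s. g \<in> carrier G \<and> s \<in> S},
      ends = (\<lambda>e. e)\<rparr>"

definition connection_set :: "('g, 'm) monoid_scheme \<Rightarrow> 'g set \<Rightarrow> bool" where
  "connection_set G S \<longleftrightarrow>
     S \<subseteq> carrier G \<and> (\<lambda>s. inv\<^bsub>G\<^esub> s) ` S = S \<and> \<one>\<^bsub>G\<^esub> \<notin> S"

text \<open>The group is taken over the vertex type of \<open>X\<close>. This is no restriction: by
  \<open>is_cayley_graphI\<close> below, an isomorphism with a Cayley graph of a group over any type suffices.\<close>

definition is_cayley_graph :: "('v, 'e) multigraph \<Rightarrow> bool" where
  "is_cayley_graph X \<longleftrightarrow>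
     (\<exists>(G :: 'v monoid) S. group G \<and> connection_set G S \<and> multigraph_iso X (cayley_graph G S))"

definition num_iso_classes :: "('v, 'e) multigraph set \<Rightarrow> nat" where
  "num_iso_classes \<X> = card (\<X> // {(X, Y). X \<in> \<X> \<and> Y \<in> \<X> \<and> multigraph_iso X Y})"

definition gen_petersen_upto :: "nat \<Rightarrow> (gp_vertex, gp_edge) multigraph set" where
  "gen_petersen_upto N = {gen_petersen n k | n k. 3 \<le> n \<and> n \<le> N \<and> 1 \<le> k \<and> 2 * k \<le> n}"

definition num_gen_petersen :: "nat \<Rightarrow> nat" where
  "num_gen_petersen N = num_iso_classes (gen_petersen_upto N)"

definition num_cayley_gen_petersen :: "nat \<Rightarrow> nat" where
  "num_cayley_gen_petersen N = num_iso_classes {X \<in> gen_petersen_upto N. is_cayley_graph X}"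

lemma multigraph_iso_refl: "multigraph_iso X X"
  unfolding multigraph_iso_def
  by (rule exI[of _ id], rule exI[of _ id]) auto

lemma multigraph_iso_trans:
  assumes "multigraph_iso X Y" "multigraph_iso Y Z"
  shows "multigraph_iso X Z"
proof -
  obtain f p where fp: "bij_betw f (verts X) (verts Y)" "bij_betw p (edges X) (edges Y)"
    "\<forall>e\<in>edges X. ends Y (p e) = f ` ends X e"
    using assms(1) unfolding multigraph_iso_def by blast
  obtain g q where gq: "bij_betw g (verts Y) (verts Z)" "bij_betw q (edges Y) (edges Z)"
    "\<forall>e\<in>edges Y. ends Z (q e) = g ` ends Y e"
    using assms(2) unfolding multigraph_iso_def by blast
  have "bij_betw (g \<circ> f) (verts X) (verts Z)" "bij_betw (q \<circ> p) (edges X) (edges Z)"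
    using fp gq by (auto intro: bij_betw_trans)
  moreover have "\<forall>e\<in>edges X. ends Z ((q \<circ> p) e) = (g \<circ> f) ` ends X e"
    using fp gq by (auto simp: image_comp dest: bij_betwE)
  ultimately show ?thesis unfolding multigraph_iso_def by blast
qed

lemma multigraph_iso_sym:
  assumes wf: "\<And>e. e \<in> edges X \<Longrightarrow> ends X e \<subseteq> verts X" and "multigraph_iso X Y"
  shows "multigraph_iso Y X"
proof -
  obtain f p where fp: "bij_betw f (verts X) (verts Y)" "bij_betw p (edges X) (edges Y)"
    "\<forall>e\<in>edges X. ends Y (p e) = f ` ends X e"
    using assms(2) unfolding multigraph_iso_def by blast
  let ?g = "inv_into (verts X) f" and ?q = "inv_into (edges X) p"
  have "ends X (?q d) = ?g ` ends Y d" if d: "d \<in> edges Y" for d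
  proof -
    have e: "?q d \<in> edges X" "p (?q d) = d"
      using d fp(2) by (auto simp: bij_betw_def inv_into_into f_inv_into_f)
    have "?g ` ends Y d = ?g ` f ` ends X (?q d)" using fp(3) e by metis
    also have "\<dots> = ends X (?q d)"
      using wf[OF e(1)] fp(1) by (simp add: bij_betw_def inv_into_image_cancel)
    finally show ?thesis by simp
  qed
  moreover have "bij_betw ?g (verts Y) (verts X)" "bij_betw ?q (edges Y) (edges X)"
    using fp by (auto intro: bij_betw_inv_into)
  ultimately show ?thesis unfolding multigraph_iso_def by blast
qed

lemma gen_petersen_ends:
  assumes "X \<in> gen_petersen_upto N" "e \<in> edges X"
  shows "ends X e \<subseteq> verts X"
  using assms by (auto simp: gen_petersen_upto_def gen_petersen_def)

lemma equiv_gen_petersen_iso: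
  assumes "\<X> \<subseteq> gen_petersen_upto N"
  shows "equiv \<X> {(X, Y). X \<in> \<X> \<and> Y \<in> \<X> \<and> multigraph_iso X Y}"
proof -
  have "multigraph_iso Y X" if "X \<in> \<X>" "multigraph_iso X Y" for X Y
    by (rule multigraph_iso_sym[OF gen_petersen_ends that(2)]) (use that(1) assms in auto)
  then show ?thesis
    by (intro equivI refl_onI symI transI)
      (auto simp: multigraph_iso_refl dest: multigraph_iso_trans)
qed

lemma finite_gen_petersen_upto: "finite (gen_petersen_upto N)"
proof (rule finite_subset)
  show "gen_petersen_upto N \<subseteq> (\<lambda>(n, k). gen_petersen n k) ` ({0..N} \<times> {0..N})"
    by (auto simp: gen_petersen_upto_def image_iff)
qed simp

lemma is_cayley_graphI:
  fixes X :: "('v, 'e) multigraph" and G :: "('g, 'm) monoid_scheme" (structure)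
  assumes G: "group G" and S: "connection_set G S" and iso: "multigraph_iso X (cayley_graph G S)"
  shows "is_cayley_graph X"
proof -
  interpret group G by (rule G)
  obtain f where f: "bij_betw f (verts X) (carrier G)"
    using iso unfolding multigraph_iso_def cayley_graph_def by auto
  define h where "h = inv_into (verts X) f"
  have h: "bij_betw h (carrier G) (verts X)" using f by (simp add: h_def bij_betw_inv_into)
  have fh: "f (h x) = x" if "x \<in> carrier G" for x
    using f that by (auto simp: h_def bij_betw_def f_inv_into_f)
  define H where "H = \<lparr>carrier = verts X, monoid.mult = (\<lambda>x y. h (f x \<otimes> f y)), one = h \<one>\<rparr>"
  have cH: "carrier H = verts X" "carrier H = h ` carrier G"
    using h by (simp_all add: H_def bij_betw_def)
  have hm: "h \<in> hom G H"
    using h fh by (auto simp: hom_def H_def dest: bij_betwE)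
  have hi: "h \<in> Group.iso G H" using hm h by (simp add: Group.iso_def H_def)
  have "group (H\<lparr>one := h \<one>\<rparr>)" by (rule iso_imp_img_group[OF hi])
  then have H: "group H" by (simp add: H_def)
  interpret hh: group_hom G H h
    using G H hm by (simp add: group_hom_def group_hom_axioms_def)
  have inj: "inj_on h (carrier G)" using h by (simp add: bij_betw_def)
  have SG: "S \<subseteq> carrier G" "(\<lambda>s. inv s) ` S = S" "\<one> \<notin> S" using S by (auto simp: connection_set_def)
  have "connection_set H (h ` S)"
    unfolding connection_set_def
  proof (intro conjI)
    show "h ` S \<subseteq> carrier H" using SG(1) by auto
    have "(\<lambda>s. inv\<^bsub>H\<^esub> s) ` h ` S = h ` (\<lambda>s. inv s) ` S"
      unfolding image_image by (rule image_cong) (use SG(1) in auto)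
    then show "(\<lambda>s. inv\<^bsub>H\<^esub> s) ` h ` S = h ` S" using SG(2) by simp
    show "\<one>\<^bsub>H\<^esub> \<notin> h ` S"
    proof
      assume "\<one>\<^bsub>H\<^esub> \<in> h ` S"
      then obtain s where s: "s \<in> S" "h s = h \<one>" by force
      then have "s = \<one>" using inj_onD[OF inj s(2) _ one_closed] SG(1) by blast
      then show False using s SG(3) by simp
    qed
  qed
  moreover have "multigraph_iso (cayley_graph G S) (cayley_graph H (h ` S))"
  proof -
    let ?E = "edges (cayley_graph G S)"
    have sub: "?E \<subseteq> Pow (carrier G)" using SG(1) by (auto simp: cayley_graph_def)
    have hE: "h ` {g, g \<otimes> s} = {h g, h g \<otimes>\<^bsub>H\<^esub> h s}" if "g \<in> carrier G" "s \<in> S" for g s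
      using that SG(1) by auto
    have "(`) h ` ?E = edges (cayley_graph H (h ` S))"
    proof (intro equalityI subsetI)
      fix d assume "d \<in> (`) h ` ?E"
      then obtain g s where "g \<in> carrier G" "s \<in> S" "d = h ` {g, g \<otimes> s}"
        by (auto simp: cayley_graph_def)
      then have "d = {h g, h g \<otimes>\<^bsub>H\<^esub> h s}" "h g \<in> carrier H" "h s \<in> h ` S"
        using hE by auto
      then show "d \<in> edges (cayley_graph H (h ` S))"
        unfolding cayley_graph_def multigraph.simps by blast
    next
      fix d assume "d \<in> edges (cayley_graph H (h ` S))"
      then obtain x s where x: "x \<in> carrier H" "s \<in> S" "d = {x, x \<otimes>\<^bsub>H\<^esub> h s}"
        by (auto simp: cayley_graph_def)
      moreover obtain g where "g \<in> carrier G" "x = h g"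
        using x(1) cH(2) by blast
      ultimately have "d = h ` {g, g \<otimes> s}" "{g, g \<otimes> s} \<in> ?E"
        using hE[of g s] unfolding cayley_graph_def multigraph.simps by (simp, blast)
      then show "d \<in> (`) h ` ?E" by blast
    qed
    moreover have "inj_on ((`) h) ?E"
      using inj_on_subset[OF inj_on_image_Pow[OF inj] sub] .
    ultimately have "bij_betw ((`) h) ?E (edges (cayley_graph H (h ` S)))"
      by (simp add: bij_betw_def)
    then show ?thesis
      unfolding multigraph_iso_def
      by (intro exI[of _ h] exI[of _ "(`) h"]) (use h in \<open>simp add: cayley_graph_def cH(1)\<close>)
  qed
  ultimately show ?thesis
    unfolding is_cayley_graph_def using H multigraph_iso_trans[OF iso] by blast
qed

end

theory Submission
  imports Defs "HOL-Real_Asymp.Real_Asymp"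
begin

text \<open>Call \<open>(n, k)\<close> generic if \<open>n\<close> divides no \<open>x + y k\<close> with \<open>(x, y) \<noteq> 0\<close> and both
  \<open>\<bar>x\<bar>, \<bar>y\<bar> \<le> 8\<close>; for each \<open>n\<close> all but boundedly many \<open>k\<close> are generic. In a generic graph a
  non-backtracking closed walk of length 8 never passes two consecutive outer or two consecutive
  inner edges, whereas a spoke followed by any other edge extends to one: such a walk lifts to two
  perpendicular families of lattice lines joined by spokes. Hence an isomorphism of generic graphs
  sends spokes to spokes and the outer rim to a walk along one kind of edge, which forces
  \<open>k \<equiv> \<plusminus>l\<close> or \<open>k l \<equiv> \<plusminus>1\<close> modulo \<open>n\<close>.

  A Cayley graph is vertex-transitive, so it has an automorphism sending a rim vertex to an inner
  vertex, which forces \<open>k\<^sup>2 \<equiv> \<plusminus>1\<close>. For fixed \<open>n\<close> and sign, \<open>k \<mapsto> gcd(n, k - k\<^sub>0)\<close> injects the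
  solutions into the divisors of \<open>n\<close>, so there are \<open>O(\<surd>n)\<close> of them and the numerator is
  \<open>O(N\<^sup>3\<^sup>/\<^sup>2)\<close>. For even \<open>n\<close> the congruences \<open>k l \<equiv> \<plusminus>1\<close> have no even solutions, so the generic graphs
  with both \<open>n\<close> and \<open>k\<close> even are pairwise non-isomorphic and the denominator grows quadratically.\<close>

section \<open>Adjacency, isomorphism and vertex-transitivity\<close>

definition wf_multigraph :: "('v, 'e) multigraph \<Rightarrow> bool" where
  "wf_multigraph X \<longleftrightarrow> (\<forall>e\<in>edges X. ends X e \<subseteq> verts X)"

definition adjacent :: "('v, 'e) multigraph \<Rightarrow> 'v \<Rightarrow> 'v \<Rightarrow> bool" where
  "adjacent X u v \<longleftrightarrow> (\<exists>e\<in>edges X. ends X e = {u, v})"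

definition adjacency_iso :: "('v, 'e) multigraph \<Rightarrow> ('w, 'd) multigraph \<Rightarrow> ('v \<Rightarrow> 'w) \<Rightarrow> bool" where
  "adjacency_iso X Y f \<longleftrightarrow> bij_betw f (verts X) (verts Y) \<and>
     (\<forall>u\<in>verts X. \<forall>v\<in>verts X. adjacent Y (f u) (f v) \<longleftrightarrow> adjacent X u v)"

definition vertex_transitive :: "('v, 'e) multigraph \<Rightarrow> bool" where
  "vertex_transitive X \<longleftrightarrow>
     (\<forall>u\<in>verts X. \<forall>v\<in>verts X. \<exists>f. adjacency_iso X X f \<and> f u = v)"

lemma adjacent_in_verts:
  assumes "wf_multigraph X" "adjacent X u v"
  shows "u \<in> verts X" "v \<in> verts X"
  using assms by (auto simp: wf_multigraph_def adjacent_def)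

lemma adjacency_iso_eq_iff:
  assumes "adjacency_iso X Y f" "u \<in> verts X" "v \<in> verts X"
  shows "f u = f v \<longleftrightarrow> u = v"
  using assms by (auto simp: adjacency_iso_def bij_betw_def inj_on_eq_iff)

lemma adjacency_iso_adjacent:
  assumes "adjacency_iso X Y f" "wf_multigraph X" "adjacent X u v"
  shows "adjacent Y (f u) (f v)"
  using assms adjacent_in_verts by (metis adjacency_iso_def)

lemma adjacency_iso_comp:
  assumes "adjacency_iso X Y f" "adjacency_iso Y Z g"
  shows "adjacency_iso X Z (g \<circ> f)"
  using assms by (auto simp: adjacency_iso_def intro: bij_betw_trans dest: bij_betwE)

lemma adjacency_iso_inv_into:
  assumes "adjacency_iso X Y f"
  shows "adjacency_iso Y X (inv_into (verts X) f)"
proof -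
  have f: "bij_betw f (verts X) (verts Y)" using assms by (simp add: adjacency_iso_def)
  have "inv_into (verts X) f w \<in> verts X \<and> f (inv_into (verts X) f w) = w" if "w \<in> verts Y" for w
    using f that by (auto simp: bij_betw_def inv_into_into f_inv_into_f)
  then show ?thesis
    using assms bij_betw_inv_into[OF f] unfolding adjacency_iso_def by metis
qed

lemma multigraph_iso_imp_adjacency_iso:
  assumes "wf_multigraph X" "multigraph_iso X Y"
  obtains f where "adjacency_iso X Y f"
proof -
  obtain f \<phi> where f: "bij_betw f (verts X) (verts Y)" and \<phi>: "bij_betw \<phi> (edges X) (edges Y)"
    and ends: "\<And>e. e \<in> edges X \<Longrightarrow> ends Y (\<phi> e) = f ` ends X e"
    using assms(2) unfolding multigraph_iso_def by blast
  have "adjacent Y (f u) (f v) \<longleftrightarrow> adjacent X u v" if uv: "u \<in> verts X" "v \<in> verts X" for u v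
  proof -
    have "ends Y (\<phi> e) = {f u, f v} \<longleftrightarrow> ends X e = {u, v}" if "e \<in> edges X" for e
      using inj_on_image_eq_iff[OF bij_betw_imp_inj_on[OF f], of "ends X e" "{u, v}"]
        ends[OF that] assms(1) that uv by (simp add: wf_multigraph_def)
    then show ?thesis
      by (simp add: adjacent_def flip: bij_betw_imp_surj_on[OF \<phi>])
  qed
  then have "adjacency_iso X Y f" using f by (simp add: adjacency_iso_def)
  then show thesis by (rule that)
qed

lemma adjacency_iso_vertex_transitive:
  assumes f: "adjacency_iso X Y f" and Y: "vertex_transitive Y"
  shows "vertex_transitive X"
  unfolding vertex_transitive_def
proof (intro ballI)
  fix u v assume uv: "u \<in> verts X" "v \<in> verts X"
  let ?g = "inv_into (verts X) f"
  have bij: "bij_betw f (verts X) (verts Y)" using f by (simp add: adjacency_iso_def)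
  then have "f u \<in> verts Y" "f v \<in> verts Y" using uv by (auto dest: bij_betwE)
  then obtain h where h: "adjacency_iso Y Y h" "h (f u) = f v"
    using Y by (auto simp: vertex_transitive_def)
  have "adjacency_iso X X (?g \<circ> (h \<circ> f))"
    by (intro adjacency_iso_comp[OF adjacency_iso_comp[OF f h(1)]] adjacency_iso_inv_into f)
  moreover have "(?g \<circ> (h \<circ> f)) u = v"
    using h(2) uv(2) bij by (simp add: bij_betw_def)
  ultimately show "\<exists>f. adjacency_iso X X f \<and> f u = v" by blast
qed

lemma adjacent_cayley_graph_iff:
  fixes G (structure)
  assumes G: "group G" and S: "connection_set G S" and xy: "x \<in> carrier G" "y \<in> carrier G"
  shows "adjacent (cayley_graph G S) x y \<longleftrightarrow> inv x \<otimes> y \<in> S"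
proof
  interpret group G by (rule G)
  have S: "S \<subseteq> carrier G" "\<And>s. s \<in> S \<Longrightarrow> inv s \<in> S"
    using S by (auto simp: connection_set_def)
  show "inv x \<otimes> y \<in> S" if "adjacent (cayley_graph G S) x y"
  proof -
    obtain g s where g: "g \<in> carrier G" and s: "s \<in> S" and "{g, g \<otimes> s} = {x, y}"
      using \<open>adjacent (cayley_graph G S) x y\<close> by (auto simp: adjacent_def cayley_graph_def)
    then consider "x = g" "y = g \<otimes> s" | "x = g \<otimes> s" "y = g"
      by (auto simp: doubleton_eq_iff)
    then show ?thesis
    proof cases
      case 1
      then show ?thesis using g s S(1) by (auto simp flip: m_assoc)
    next
      case 2
      then have "inv x \<otimes> y = inv s" using g s S(1) by (auto simp: inv_mult_group m_assoc)
      then show ?thesis using S(2)[OF s] by simp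
    qed
  qed
  show "adjacent (cayley_graph G S) x y" if "inv x \<otimes> y \<in> S"
  proof -
    have "{x, y} = {x, x \<otimes> (inv x \<otimes> y)}" using xy by (simp flip: m_assoc)
    then show ?thesis
      using that xy(1) unfolding adjacent_def cayley_graph_def multigraph.simps by blast
  qed
qed

lemma vertex_transitive_cayley_graph:
  fixes G (structure)
  assumes G: "group G" and S: "connection_set G S"
  shows "vertex_transitive (cayley_graph G S)"
proof -
  interpret group G by (rule G)
  have verts: "verts (cayley_graph G S) = carrier G" by (simp add: cayley_graph_def)
  have translation: "adjacency_iso (cayley_graph G S) (cayley_graph G S) (\<lambda>x. h \<otimes> x)"
    if h: "h \<in> carrier G" for h
  proof -
    have "bij_betw (\<lambda>x. h \<otimes> x) (carrier G) (carrier G)"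
      using inj_on_cmult[OF h] surj_const_mult[OF h] by (simp add: bij_betw_def)
    moreover have "inv (h \<otimes> x) \<otimes> (h \<otimes> y) = inv x \<otimes> y"
      if "x \<in> carrier G" "y \<in> carrier G" for x y
      using h that by (simp add: inv_mult_group m_assoc inv_solve_left')
    ultimately show ?thesis
      using h by (simp add: adjacency_iso_def verts adjacent_cayley_graph_iff[OF G S])
  qed
  show ?thesis
    unfolding vertex_transitive_def verts
  proof (intro ballI)
    fix u v assume "u \<in> carrier G" "v \<in> carrier G"
    then show "\<exists>f. adjacency_iso (cayley_graph G S) (cayley_graph G S) f \<and> f u = v"
      using translation[of "v \<otimes> inv u"] by (auto simp: m_assoc intro!: exI)
  qed
qed

lemma is_cayley_graph_imp_vertex_transitive:
  assumes "wf_multigraph X" "is_cayley_graph X"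
  shows "vertex_transitive X"
  using assms multigraph_iso_imp_adjacency_iso adjacency_iso_vertex_transitive
    vertex_transitive_cayley_graph unfolding is_cayley_graph_def by metis

section \<open>Non-backtracking walks\<close>

fun nonbacktracking :: "('v \<Rightarrow> 'v \<Rightarrow> bool) \<Rightarrow> 'v list \<Rightarrow> bool" where
  "nonbacktracking R (u # v # w # ws) \<longleftrightarrow> R u v \<and> u \<noteq> w \<and> nonbacktracking R (v # w # ws)"
| "nonbacktracking R [u, v] \<longleftrightarrow> R u v"
| "nonbacktracking R _ \<longleftrightarrow> True"

text \<open>\<open>m\<close> counts edges, and the walk may backtrack at its base point \<open>u\<close>.\<close>

definition closed_walk_through :: "nat \<Rightarrow> ('v \<Rightarrow> 'v \<Rightarrow> bool) \<Rightarrow> 'v \<Rightarrow> 'v \<Rightarrow> 'v \<Rightarrow> bool" where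
  "closed_walk_through m R u v w \<longleftrightarrow>
     (\<exists>ws. length ws + 3 = m \<and> nonbacktracking R (u # v # w # ws @ [u]))"

lemma nonbacktracking_Cons2D:
  assumes "nonbacktracking R (u # v # ws)"
  shows "R u v" "nonbacktracking R (v # ws)"
  using assms by (cases ws; simp)+

lemma nonbacktracking_map:
  assumes hom: "\<And>u v. R u v \<Longrightarrow> S (f u) (f v)"
    and locally_inj: "\<And>u v w. R u v \<Longrightarrow> R v w \<Longrightarrow> u \<noteq> w \<Longrightarrow> f u \<noteq> f w"
    and "nonbacktracking R ws"
  shows "nonbacktracking S (map f ws)"
  using assms(3)
proof (induction ws rule: induct_list012)
  case (3 u v ws)
  show ?case
  proof (cases ws)
    case Nil
    then show ?thesis using 3 hom by simp
  next
    case (Cons w ws')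
    then have uv: "R u v" and uw: "u \<noteq> w" and tail: "nonbacktracking R (v # w # ws')"
      using "3.prems" by simp_all
    have "f u \<noteq> f w" by (rule locally_inj[OF uv nonbacktracking_Cons2D(1)[OF tail] uw])
    then show ?thesis using "3.IH"(2) tail hom[OF uv] Cons by simp
  qed
qed simp_all

lemma closed_walk_through_map:
  assumes "closed_walk_through m R u v w"
    and "\<And>u v. R u v \<Longrightarrow> S (f u) (f v)"
    and "\<And>u v w. R u v \<Longrightarrow> R v w \<Longrightarrow> u \<noteq> w \<Longrightarrow> f u \<noteq> f w"
  shows "closed_walk_through m S (f u) (f v) (f w)"
proof -
  obtain ws where "length ws + 3 = m" "nonbacktracking R (u # v # w # ws @ [u])"
    using assms(1) by (auto simp: closed_walk_through_def)
  then show ?thesis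
    using nonbacktracking_map[of R S f "u # v # w # ws @ [u]"] assms(2,3)
    by (auto simp: closed_walk_through_def intro!: exI[of _ "map f ws"])
qed

lemma closed_walk_through_adjacency_iso:
  assumes X: "wf_multigraph X" and f: "adjacency_iso X Y f"
    and walk: "closed_walk_through m (adjacent X) u v w"
  shows "closed_walk_through m (adjacent Y) (f u) (f v) (f w)"
  using walk
proof (rule closed_walk_through_map)
  show "adjacent Y (f u) (f v)" if "adjacent X u v" for u v
    by (rule adjacency_iso_adjacent[OF f X that])
  show "f u \<noteq> f w" if "adjacent X u v" "adjacent X v w" "u \<noteq> w" for u v w
    using that adjacent_in_verts[OF X] adjacency_iso_eq_iff[OF f] by metis
qed

lemma nonbacktracking_lift:
  assumes lift: "\<And>c w. R (\<pi> c) w \<Longrightarrow> \<exists>d. T c d \<and> \<pi> d = w"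
    and "T b c" "nonbacktracking R (\<pi> b # \<pi> c # ws)"
  obtains ds where "map \<pi> ds = ws" "nonbacktracking T (b # c # ds)"
  using assms(2,3)
proof (induction ws arbitrary: b c thesis)
  case Nil
  then show ?case by simp
next
  case (Cons w ws)
  have "R (\<pi> c) w" using Cons.prems(3) nonbacktracking_Cons2D by fastforce
  then obtain d where d: "T c d" "\<pi> d = w" using lift by blast
  then have "nonbacktracking R (\<pi> c # \<pi> d # ws)" using Cons.prems(3) by simp
  then obtain ds where "map \<pi> ds = ws" "nonbacktracking T (c # d # ds)"
    using Cons.IH d(1) by blast
  moreover have "b \<noteq> d" using Cons.prems(3) d(2) by auto
  ultimately show ?case
    using Cons.prems(1)[of "d # ds"] Cons.prems(2) d(2) by simp
qed

section \<open>Coordinates on generalised Petersen graphs\<close>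

definition vert :: "nat \<Rightarrow> bool \<Rightarrow> int \<Rightarrow> gp_vertex" where
  "vert n t i = (if t then B_vertex else A_vertex) (nat (i mod int n))"

definition stride :: "nat \<Rightarrow> bool \<Rightarrow> int" where
  "stride k t = (if t then int k else 1)"

lemma vert_eq_iff:
  assumes "n > 0"
  shows "vert n t i = vert n s j \<longleftrightarrow> t = s \<and> int n dvd i - j"
proof -
  have "nat (i mod int n) = nat (j mod int n) \<longleftrightarrow> int n dvd i - j"
    using assms by (simp add: eq_nat_nat_iff mod_eq_dvd_iff)
  then show ?thesis by (simp add: vert_def)
qed

lemma vert_in_verts: "n > 0 \<Longrightarrow> vert n t i \<in> verts (gen_petersen n k)"
  by (auto simp: vert_def gen_petersen_def nat_less_iff)

lemma vert_exhaust:
  assumes "v \<in> verts (gen_petersen n k)"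
  obtains t i where "v = vert n t i"
proof -
  from assms consider j where "j < n" "v = A_vertex j" | j where "j < n" "v = B_vertex j"
    by (auto simp: gen_petersen_def)
  then show thesis
  proof cases
    case (1 j)
    then show thesis using that[of False "int j"] by (simp add: vert_def)
  next
    case (2 j)
    then show thesis using that[of True "int j"] by (simp add: vert_def)
  qed
qed

lemma card_verts_gen_petersen: "card (verts (gen_petersen n k)) = 2 * n"
proof -
  have "card (A_vertex ` {0..<n} \<union> B_vertex ` {0..<n})
      = card (A_vertex ` {0..<n}) + card (B_vertex ` {0..<n})"
    by (rule card_Un_disjoint) auto
  then show ?thesis by (simp add: gen_petersen_def card_image inj_on_def)
qed

lemma wf_gen_petersen: "wf_multigraph (gen_petersen n k)"
  by (auto simp: wf_multigraph_def gen_petersen_def)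

lemma gp_ends_eq_vert:
  assumes "j < n"
  shows "gp_ends n k (Outer j) = {vert n False (int j), vert n False (int j + 1)}"
    and "gp_ends n k (Spoke j) = {vert n False (int j), vert n True (int j)}"
    and "gp_ends n k (Inner j) = {vert n True (int j), vert n True (int j + int k)}"
proof -
  have "(j + d) mod n = nat ((int j + int d) mod int n)" for d
    by (simp flip: of_nat_add of_nat_mod)
  from this[of 1] this[of k] assms show
    "gp_ends n k (Outer j) = {vert n False (int j), vert n False (int j + 1)}"
    "gp_ends n k (Spoke j) = {vert n False (int j), vert n True (int j)}"
    "gp_ends n k (Inner j) = {vert n True (int j), vert n True (int j + int k)}"
    by (simp_all add: vert_def)
qed

lemma ends_gen_petersen_image:
  assumes n: "n > 0"
  shows "ends (gen_petersen n k) ` edges (gen_petersen n k) =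
      {{vert n t i, vert n t (i + stride k t)} | t i. True} \<union>
      {{vert n False i, vert n True i} | i. True}"
    (is "?E = ?lines \<union> ?spokes")
proof (intro equalityI subsetI)
  fix e assume "e \<in> ?E"
  then obtain j where j: "j < n"
      and e: "e \<in> {gp_ends n k (Outer j), gp_ends n k (Spoke j), gp_ends n k (Inner j)}"
    by (auto simp: gen_petersen_def)
  have "e \<in> {{vert n False (int j), vert n False (int j + stride k False)},
      {vert n False (int j), vert n True (int j)},
      {vert n True (int j), vert n True (int j + stride k True)}}"
    using e unfolding gp_ends_eq_vert[OF j] by (simp add: stride_def)
  then show "e \<in> ?lines \<union> ?spokes" by blast
next
  fix e assume "e \<in> ?lines \<union> ?spokes"
  then obtain t i
    where e: "e \<in> {{vert n t i, vert n t (i + stride k t)}, {vert n False i, vert n True i}}"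
    by blast
  define j where "j = nat (i mod int n)"
  have j: "j < n" "int j = i mod int n" using n by (simp_all add: j_def nat_less_iff)
  have "vert n s (int j + d) = vert n s (i + d)" for s d
    by (simp add: vert_def j(2) mod_add_left_eq)
  from this[of _ 0] this e have "e \<in> gp_ends n k ` {Outer j, Spoke j, Inner j}"
    by (cases t) (auto simp: gp_ends_eq_vert[OF j(1)] stride_def simp del: gp_ends.simps)
  then show "e \<in> ?E" using j(1) by (auto simp: gen_petersen_def simp del: gp_ends.simps)
qed

lemma line_doubleton_iff:
  assumes n: "n > 0"
  shows "(\<exists>s j. {vert n t i, w} = {vert n s j, vert n s (j + stride k s)}) \<longleftrightarrow>
    w = vert n t (i + stride k t) \<or> w = vert n t (i - stride k t)" (is "?L \<longleftrightarrow> ?R")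
proof
  have shift: "s = t \<and> vert n s (j + d) = vert n t (i + d)" if "vert n s j = vert n t i" for s j i d
    using that n by (simp add: vert_eq_iff)
  assume ?L
  then obtain s j where "{vert n t i, w} = {vert n s j, vert n s (j + stride k s)}" by blast
  then consider "vert n s j = vert n t i" "w = vert n s (j + stride k s)"
    | "vert n s (j + stride k s) = vert n t i" "w = vert n s j"
    by (auto simp: doubleton_eq_iff)
  then show ?R
  proof cases
    case 1
    then show ?thesis using shift by blast
  next
    case 2
    then show ?thesis using shift[OF 2(1), of "- stride k s"] by auto
  qed
next
  assume ?R
  then consider "w = vert n t (i + stride k t)" | "w = vert n t (i - stride k t)" by blast
  then show ?L
  proof cases
    case 1
    then show ?thesis by (intro exI[of _ t] exI[of _ i]) simp
  next
    case 2
    then show ?thesis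
      by (intro exI[of _ t] exI[of _ "i - stride k t"]) (simp add: insert_commute)
  qed
qed

lemma spoke_doubleton_iff:
  assumes n: "n > 0"
  shows "(\<exists>j. {vert n t i, w} = {vert n False j, vert n True j}) \<longleftrightarrow> w = vert n (\<not> t) i"
proof
  assume "\<exists>j. {vert n t i, w} = {vert n False j, vert n True j}"
  then obtain j s where "vert n s j = vert n t i" "w = vert n (\<not> s) j"
    by (auto simp: doubleton_eq_iff)
  then show "w = vert n (\<not> t) i" using n by (simp add: vert_eq_iff)
next
  assume "w = vert n (\<not> t) i"
  then show "\<exists>j. {vert n t i, w} = {vert n False j, vert n True j}"
    by (cases t) (auto intro: exI[of _ i])
qed

lemma adjacent_vert_iff:
  assumes n: "n > 0"
  shows "adjacent (gen_petersen n k) (vert n t i) w \<longleftrightarrow>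
    w = vert n t (i + stride k t) \<or> w = vert n t (i - stride k t) \<or> w = vert n (\<not> t) i"
proof -
  have "adjacent (gen_petersen n k) (vert n t i) w \<longleftrightarrow>
      {vert n t i, w} \<in> ends (gen_petersen n k) ` edges (gen_petersen n k)"
    by (auto simp: adjacent_def)
  then show ?thesis
    unfolding ends_gen_petersen_image[OF n]
    using line_doubleton_iff[OF n, of t i w k] spoke_doubleton_iff[OF n, of t i w] by simp
qed

section \<open>Closed walks and the covering lattice\<close>

definition generic :: "nat \<Rightarrow> nat \<Rightarrow> nat \<Rightarrow> bool" where
  "generic r n k \<longleftrightarrow> (\<forall>x y. \<bar>x\<bar> \<le> int r \<longrightarrow> \<bar>y\<bar> \<le> int r \<longrightarrow>
     int n dvd x + y * int k \<longrightarrow> x = 0 \<and> y = 0)"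

lemma generic_stride:
  assumes "generic r n k" "\<bar>x\<bar> \<le> int r" "\<bar>y\<bar> \<le> int r"
    and "int n dvd x * stride k t + y * stride k (\<not> t)"
  shows "x = 0 \<and> y = 0"
  using assms unfolding generic_def stride_def
  by (cases t) (auto simp: add.commute)

text \<open>The cover of the generalised Petersen graphs: horizontal lines of vertices \<open>(False, x, y)\<close> and
  vertical lines of vertices \<open>(True, x, y)\<close>, joined by spokes. The covering map sends the origin to
  \<open>vert n t i\<close> and the first horizontal step to \<open>\<epsilon>\<close> times the stride there.\<close>

fun cover_adjacent :: "bool \<times> int \<times> int \<Rightarrow> bool \<times> int \<times> int \<Rightarrow> bool" where
  "cover_adjacent (s, x, y) d \<longleftrightarrow> d = (\<not> s, x, y) \<or>
     (if s then d = (s, x, y + 1) \<or> d = (s, x, y - 1) else d = (s, x + 1, y) \<or> d = (s, x - 1, y))"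

fun cover_dist :: "bool \<times> int \<times> int \<Rightarrow> bool \<times> int \<times> int \<Rightarrow> int" where
  "cover_dist (s, x, y) (s', x', y') = max \<bar>x - x'\<bar> \<bar>y - y'\<bar>"

fun cover_map :: "nat \<Rightarrow> nat \<Rightarrow> bool \<Rightarrow> int \<Rightarrow> int \<Rightarrow> bool \<times> int \<times> int \<Rightarrow> gp_vertex" where
  "cover_map n k t \<epsilon> i (s, x, y) = vert n (s \<noteq> t) (i + x * (\<epsilon> * stride k t) + y * stride k (\<not> t))"

lemma adjacent_cover_map_iff:
  assumes n: "n > 0" and \<epsilon>: "\<epsilon> \<in> {1, - 1}"
  shows "adjacent (gen_petersen n k) (cover_map n k t \<epsilon> i c) w \<longleftrightarrow>
    (\<exists>d. cover_adjacent c d \<and> cover_map n k t \<epsilon> i d = w)"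
proof -
  obtain s x y where c: "c = (s, x, y)" by (cases c)
  let ?\<pi> = "cover_map n k t \<epsilon> i"
  have "(\<exists>d. cover_adjacent c d \<and> ?\<pi> d = w) \<longleftrightarrow> w = ?\<pi> (\<not> s, x, y) \<or>
      (if s then w = ?\<pi> (s, x, y + 1) \<or> w = ?\<pi> (s, x, y - 1)
       else w = ?\<pi> (s, x + 1, y) \<or> w = ?\<pi> (s, x - 1, y))"
    unfolding c cover_adjacent.simps by (cases s; simp only: if_True if_False; blast)
  moreover from \<epsilon> have "\<epsilon> = 1 \<or> \<epsilon> = - 1" by simp
  ultimately show ?thesis
    by (cases s) (auto simp: c adjacent_vert_iff[OF n] algebra_simps simp del: cover_adjacent.simps)
qed

lemma cover_map_eq_iff:
  assumes n: "n > 0" and \<epsilon>: "\<epsilon> \<in> {1, - 1}" and g: "generic r n k"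
    and near: "cover_dist c d \<le> int r"
  shows "cover_map n k t \<epsilon> i c = cover_map n k t \<epsilon> i d \<longleftrightarrow> c = d"
proof
  obtain s x y where c: "c = (s, x, y)" by (cases c)
  obtain s' x' y' where d: "d = (s', x', y')" by (cases d)
  assume "cover_map n k t \<epsilon> i c = cover_map n k t \<epsilon> i d"
  then have "s = s'" and
    "int n dvd (i + x * (\<epsilon> * stride k t) + y * stride k (\<not> t))
      - (i + x' * (\<epsilon> * stride k t) + y' * stride k (\<not> t))"
    by (auto simp: c d vert_eq_iff[OF n])
  moreover from this(2) have
    "int n dvd ((x - x') * \<epsilon>) * stride k t + (y - y') * stride k (\<not> t)"
    by (simp add: algebra_simps)
  moreover have "\<bar>(x - x') * \<epsilon>\<bar> \<le> int r" "\<bar>y - y'\<bar> \<le> int r"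
    using near \<epsilon> by (auto simp: c d)
  ultimately show "c = d"
    using generic_stride[OF g] \<epsilon> by (fastforce simp: c d)
qed simp

lemma cover_dist_nonbacktracking:
  assumes "nonbacktracking cover_adjacent (c # cs)"
  shows "cover_dist c (last (c # cs)) \<le> int (length cs)"
  using assms
proof (induction cs arbitrary: c)
  case Nil
  then show ?case by (cases c) simp
next
  case (Cons d cs)
  have triangle: "cover_dist c e \<le> cover_dist c d + cover_dist d e" for e
    by (cases c; cases d; cases e) auto
  have "cover_adjacent c d" "nonbacktracking cover_adjacent (d # cs)"
    using nonbacktracking_Cons2D[OF Cons.prems] .
  moreover from this(1) have "cover_dist c d \<le> 1" by (cases c) (auto split: if_splits)
  ultimately show ?case using Cons.IH triangle[of "last (d # cs)"] by fastforce
qed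

lemma closed_walk_through_cover_map:
  assumes n: "n > 0" and \<epsilon>: "\<epsilon> \<in> {1, - 1}" and g: "generic m n k"
    and walk: "closed_walk_through m cover_adjacent a b c"
  shows "closed_walk_through m (adjacent (gen_petersen n k))
    (cover_map n k t \<epsilon> i a) (cover_map n k t \<epsilon> i b) (cover_map n k t \<epsilon> i c)"
  using walk
proof (rule closed_walk_through_map)
  let ?\<pi> = "cover_map n k t \<epsilon> i"
  show "adjacent (gen_petersen n k) (?\<pi> u) (?\<pi> v)" if "cover_adjacent u v" for u v
    unfolding adjacent_cover_map_iff[OF n \<epsilon>] using that by blast
  show "?\<pi> u \<noteq> ?\<pi> w" if "cover_adjacent u v" "cover_adjacent v w" "u \<noteq> w" for u v w
  proof -
    have "3 \<le> m" using walk by (auto simp: closed_walk_through_def)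
    moreover have "nonbacktracking cover_adjacent [u, v, w]" using that by simp
    ultimately have "cover_dist u w \<le> int m"
      using cover_dist_nonbacktracking[of u "[v, w]"] by simp
    then show ?thesis using cover_map_eq_iff[OF n \<epsilon> g] that(3) by blast
  qed
qed

text \<open>Genericity makes the end of the lifted walk coincide with its start.\<close>

lemma closed_walk_through_lift:
  fixes t :: bool and i :: int
  assumes n: "n > 0" and \<epsilon>: "\<epsilon> \<in> {1, - 1}" and g: "generic m n k"
    and ab: "cover_adjacent a b" and bc: "cover_adjacent b c" and ac: "a \<noteq> c"
  defines "\<pi> \<equiv> cover_map n k t \<epsilon> i"
  assumes walk: "closed_walk_through m (adjacent (gen_petersen n k)) (\<pi> a) (\<pi> b) (\<pi> c)"
  shows "closed_walk_through m cover_adjacent a b c"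
proof -
  let ?R = "adjacent (gen_petersen n k)"
  obtain ws where ws: "length ws + 3 = m"
      and "nonbacktracking ?R (\<pi> a # \<pi> b # \<pi> c # ws @ [\<pi> a])"
    using walk by (auto simp: closed_walk_through_def)
  then have "nonbacktracking ?R (\<pi> b # \<pi> c # ws @ [\<pi> a])" by simp
  moreover have "\<exists>d. cover_adjacent c d \<and> \<pi> d = w" if "?R (\<pi> c) w" for c w
    using that unfolding \<pi>_def adjacent_cover_map_iff[OF n \<epsilon>] .
  ultimately obtain ds where ds: "map \<pi> ds = ws @ [\<pi> a]"
      and "nonbacktracking cover_adjacent (b # c # ds)"
    using nonbacktracking_lift[of ?R \<pi> cover_adjacent, OF _ bc] by blast
  then have lifted: "nonbacktracking cover_adjacent (a # b # c # ds)" using ab ac by simp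
  obtain vs d where vs: "ds = vs @ [d]" "length vs = length ws" and d: "\<pi> d = \<pi> a"
    using ds by (auto simp: map_eq_append_conv)
  have "cover_dist a d \<le> int m"
    using cover_dist_nonbacktracking[OF lifted] vs ws by simp
  then have "d = a"
    using cover_map_eq_iff[OF n \<epsilon> g] d unfolding \<pi>_def by metis
  then show ?thesis
    using lifted vs ws by (auto simp: closed_walk_through_def)
qed

lemma cover_closed_walk_spoke:
  "closed_walk_through 8 cover_adjacent (True, 0, 0) (False, 0, 0) (False, 1, 0)"
  unfolding closed_walk_through_def
  by (rule exI[of _ "[(True, 1, 0), (True, 1, 1), (False, 1, 1), (False, 0, 1), (True, 0, 1)]"]) simp

text \<open>To return, the walk needs at least two steps against the first two and, since no backtracking
  is allowed, two opposite steps in the other direction and four spokes, so at least ten edges.\<close>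

lemma cover_no_closed_walk_straight:
  "\<not> closed_walk_through 8 cover_adjacent (False, - 1, 0) (False, 0, 0) (False, 1, 0)"
proof
  assume "closed_walk_through 8 cover_adjacent (False, - 1, 0) (False, 0, 0) (False, 1, 0)"
  then obtain ws where "length ws = 5"
    and walk: "nonbacktracking cover_adjacent
      ((False, - 1, 0) # (False, 0, 0) # (False, 1, 0) # ws @ [(False, - 1, 0)])"
    unfolding closed_walk_through_def by auto
  then obtain a b c d e where "ws = [a, b, c, d, e]"
    by (auto simp: length_Suc_conv numeral_eq_Suc)
  with walk show False
    by (cases a; cases b; cases c; cases d; cases e) (auto split: if_splits)
qed

lemma closed_walk_through_spoke:
  assumes n: "n > 0" and g: "generic 8 n k" and \<epsilon>: "\<epsilon> \<in> {1, - 1}"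
  shows "closed_walk_through 8 (adjacent (gen_petersen n k)) (vert n (\<not> t) i) (vert n t i)
    (vert n t (i + \<epsilon> * stride k t))"
  using closed_walk_through_cover_map[OF n \<epsilon> g cover_closed_walk_spoke, of t i] by simp

lemma not_closed_walk_through_straight:
  assumes n: "n > 0" and g: "generic 8 n k" and \<epsilon>: "\<epsilon> \<in> {1, - 1}"
  shows "\<not> closed_walk_through 8 (adjacent (gen_petersen n k)) (vert n t (i - \<epsilon> * stride k t))
    (vert n t i) (vert n t (i + \<epsilon> * stride k t))"
  using closed_walk_through_lift[OF n \<epsilon> g, of "(False, - 1, 0)" "(False, 0, 0)" "(False, 1, 0)" t i]
    cover_no_closed_walk_straight by auto

section \<open>Isomorphisms of generic graphs\<close>

lemma generic_not_dvd_stride: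
  assumes "generic r n k" "\<bar>x\<bar> \<le> int r" "x \<noteq> 0"
  shows "\<not> int n dvd x * stride k t"
  using generic_stride[OF assms(1,2), of 0 t] assms(3) by auto

lemma adjacency_iso_vert_eq_iff:
  assumes "adjacency_iso (gen_petersen n k) Y f" "n > 0"
  shows "f (vert n s i) = f (vert n t j) \<longleftrightarrow> vert n s i = vert n t j"
  using adjacency_iso_eq_iff[OF assms(1)] vert_in_verts[OF assms(2)] by blast

lemma adjacency_iso_nbrs:
  assumes n: "n > 0" and f: "adjacency_iso (gen_petersen n k) (gen_petersen n l) f"
    and fv: "f (vert n s i) = vert n t c"
    and w: "w \<in> {vert n s (i + stride k s), vert n s (i - stride k s), vert n (\<not> s) i}"
  shows "f w \<in> {vert n t (c + stride l t), vert n t (c - stride l t), vert n (\<not> t) c}"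
proof -
  have "adjacent (gen_petersen n k) (vert n s i) w" using w by (auto simp: adjacent_vert_iff[OF n])
  then have "adjacent (gen_petersen n l) (vert n t c) (f w)"
    using adjacency_iso_adjacent[OF f wf_gen_petersen] fv by metis
  then show ?thesis by (simp add: adjacent_vert_iff[OF n])
qed

lemma adjacency_iso_spoke:
  assumes n: "n > 0" and gk: "generic 8 n k" and gl: "generic 8 n l"
    and f: "adjacency_iso (gen_petersen n k) (gen_petersen n l) f"
    and fv: "f (vert n s i) = vert n t c"
  shows "f (vert n (\<not> s) i) = vert n (\<not> t) c"
proof (rule ccontr)
  assume not_spoke: "f (vert n (\<not> s) i) \<noteq> vert n (\<not> t) c"
  define u v w w' where "u = vert n (\<not> s) i" and "v = vert n s i"
    and "w = vert n s (i + stride k s)" and "w' = vert n s (i - stride k s)"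
  have nbrs: "f x \<in> {vert n t (c + stride l t), vert n t (c - stride l t), vert n (\<not> t) c}"
    if "x \<in> {u, w, w'}" for x
    using that by (intro adjacency_iso_nbrs[OF n f fv]) (auto simp: u_def w_def w'_def)
  then obtain \<epsilon> :: int where \<epsilon>: "\<epsilon> \<in> {1, - 1}" and fu: "f u = vert n t (c - \<epsilon> * stride l t)"
    using not_spoke that[of 1] that[of "- 1"] by (auto simp: u_def)
  have "\<not> int n dvd 2 * stride k s" using generic_not_dvd_stride[OF gk, of 2] by simp
  then have distinct: "f u \<noteq> f w" "f u \<noteq> f w'" "f w \<noteq> f w'"
    unfolding u_def w_def w'_def adjacency_iso_vert_eq_iff[OF f n] by (auto simp: vert_eq_iff[OF n])
  then have "f x = vert n t (c + \<epsilon> * stride l t) \<or> f x = vert n (\<not> t) c" if "x \<in> {w, w'}" for x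
    using that nbrs[of x] fu \<epsilon> by (cases "\<epsilon> = 1") auto
  from this[of w] this[of w'] distinct(3)
  have "f w = vert n t (c + \<epsilon> * stride l t) \<or> f w' = vert n t (c + \<epsilon> * stride l t)" by auto
  then obtain x where x: "x \<in> {w, w'}" and fx: "f x = vert n t (c + \<epsilon> * stride l t)" by blast
  have "closed_walk_through 8 (adjacent (gen_petersen n k)) u v x"
    using x closed_walk_through_spoke[OF n gk, of 1 s i]
      closed_walk_through_spoke[OF n gk, of "- 1" s i]
    by (auto simp: u_def v_def w_def w'_def)
  then have "closed_walk_through 8 (adjacent (gen_petersen n l)) (f u) (f v) (f x)"
    by (rule closed_walk_through_adjacency_iso[OF wf_gen_petersen f])
  then show False
    unfolding fu fx v_def fv using not_closed_walk_through_straight[OF n gl \<epsilon>] by blast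
qed

lemma adjacency_iso_rim_step:
  assumes n: "n > 0" and gk: "generic 8 n k" and gl: "generic 8 n l"
    and f: "adjacency_iso (gen_petersen n k) (gen_petersen n l) f"
    and fj: "f (vert n False j) = vert n t d"
  shows "f (vert n False (j + 1)) \<in> {vert n t (d + stride l t), vert n t (d - stride l t)}"
proof -
  have "f (vert n True j) = vert n (\<not> t) d"
    using adjacency_iso_spoke[OF n gk gl f fj] by simp
  moreover have "f (vert n False (j + 1)) \<noteq> f (vert n True j)"
    unfolding adjacency_iso_vert_eq_iff[OF f n] by (simp add: vert_eq_iff[OF n])
  ultimately show ?thesis
    using adjacency_iso_nbrs[OF n f fj, of "vert n False (j + 1)"] by (auto simp: stride_def)
qed

lemma adjacency_iso_rim:
  assumes n: "n > 0" and gk: "generic 8 n k" and gl: "generic 8 n l"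
    and f: "adjacency_iso (gen_petersen n k) (gen_petersen n l) f"
    and f0: "f (vert n False 0) = vert n t c"
  obtains \<epsilon> :: int where "\<epsilon> \<in> {1, - 1}"
    and "\<And>i :: nat. f (vert n False (int i)) = vert n t (c + \<epsilon> * stride l t * int i)"
proof -
  note step = adjacency_iso_rim_step[OF n gk gl f]
  obtain \<epsilon> :: int where \<epsilon>: "\<epsilon> \<in> {1, - 1}"
    and f1: "f (vert n False 1) = vert n t (c + \<epsilon> * stride l t)"
    using step[OF f0] that[of 1] that[of "- 1"] by auto
  have "f (vert n False (int i)) = vert n t (c + \<epsilon> * stride l t * int i) \<and>
      f (vert n False (int i + 1)) = vert n t (c + \<epsilon> * stride l t * (int i + 1))" for i
  proof (induction i)
    case 0
    then show ?case using f0 f1 by simp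
  next
    case (Suc i)
    let ?d = "c + \<epsilon> * stride l t * (int i + 1)"
    have "\<not> int n dvd 2" using generic_not_dvd_stride[OF gk, of 2 False] by (simp add: stride_def)
    then have "f (vert n False (int i + 1 + 1)) \<noteq> f (vert n False (int i))"
      unfolding adjacency_iso_vert_eq_iff[OF f n] by (simp add: vert_eq_iff[OF n])
    also have "f (vert n False (int i)) = vert n t (?d - \<epsilon> * stride l t)"
      using Suc.IH by (simp add: algebra_simps)
    finally have "f (vert n False (int i + 1 + 1)) = vert n t (?d + \<epsilon> * stride l t)"
      using step[of "int i + 1" t ?d] Suc.IH \<epsilon> by auto
    then show ?case using Suc.IH by (simp add: algebra_simps)
  qed
  then show thesis using that \<epsilon> by blast
qed

lemma adjacency_iso_strides_cong:
  assumes n: "n > 0" and gk: "generic 8 n k" and gl: "generic 8 n l"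
    and f: "adjacency_iso (gen_petersen n k) (gen_petersen n l) f"
    and f0: "f (vert n False 0) = vert n t c"
  shows "int n dvd stride l t * int k - stride l (\<not> t) \<or>
    int n dvd stride l t * int k + stride l (\<not> t)"
proof -
  obtain \<epsilon> :: int where \<epsilon>: "\<epsilon> \<in> {1, - 1}"
    and rim: "\<And>i :: nat. f (vert n False (int i)) = vert n t (c + \<epsilon> * stride l t * int i)"
    using adjacency_iso_rim[OF n gk gl f f0] by blast
  have "adjacent (gen_petersen n k) (vert n True 0) (vert n True (int k))"
    by (simp add: adjacent_vert_iff[OF n] stride_def)
  then have "adjacent (gen_petersen n l) (f (vert n True 0)) (f (vert n True (int k)))"
    by (rule adjacency_iso_adjacent[OF f wf_gen_petersen])
  moreover have "f (vert n True 0) = vert n (\<not> t) c"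
    using adjacency_iso_spoke[OF n gk gl f f0] by simp
  moreover have "f (vert n True (int k)) = vert n (\<not> t) (c + \<epsilon> * stride l t * int k)"
    using adjacency_iso_spoke[OF n gk gl f rim[of k]] by simp
  ultimately have "int n dvd \<epsilon> * stride l t * int k - stride l (\<not> t) \<or>
      int n dvd \<epsilon> * stride l t * int k + stride l (\<not> t)"
    by (auto simp: adjacent_vert_iff[OF n] vert_eq_iff[OF n])
  then show ?thesis
    using \<epsilon> dvd_minus_iff[of "int n" "stride l t * int k - stride l (\<not> t)"]
      dvd_minus_iff[of "int n" "stride l t * int k + stride l (\<not> t)"]
    by auto
qed

lemma multigraph_iso_gen_petersen_imp_eq_order:
  assumes "multigraph_iso (gen_petersen n k) (gen_petersen m l)"
  shows "n = m"
proof -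
  obtain f where "adjacency_iso (gen_petersen n k) (gen_petersen m l) f"
    using multigraph_iso_imp_adjacency_iso[OF wf_gen_petersen assms] .
  then have "card (verts (gen_petersen n k)) = card (verts (gen_petersen m l))"
    unfolding adjacency_iso_def using bij_betw_same_card by blast
  then show ?thesis by (simp add: card_verts_gen_petersen)
qed

lemma multigraph_iso_gen_petersen_cong:
  assumes n: "n > 0" and gk: "generic 8 n k" and gl: "generic 8 n l"
    and iso: "multigraph_iso (gen_petersen n k) (gen_petersen n l)"
  shows "int n dvd int k - int l \<or> int n dvd int k + int l \<or>
    int n dvd int l * int k - 1 \<or> int n dvd int l * int k + 1"
proof -
  obtain f where f: "adjacency_iso (gen_petersen n k) (gen_petersen n l) f"
    using multigraph_iso_imp_adjacency_iso[OF wf_gen_petersen iso] .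
  then have "f (vert n False 0) \<in> verts (gen_petersen n l)"
    using vert_in_verts[OF n] by (auto simp: adjacency_iso_def dest: bij_betwE)
  then obtain t c where "f (vert n False 0) = vert n t c" by (rule vert_exhaust)
  from adjacency_iso_strides_cong[OF n gk gl f this] show ?thesis
    by (cases t) (auto simp: stride_def)
qed

lemma cayley_gen_petersen_cong:
  assumes n: "n > 0" and g: "generic 8 n k" and cayley: "is_cayley_graph (gen_petersen n k)"
  shows "int n dvd (int k)\<^sup>2 - 1 \<or> int n dvd (int k)\<^sup>2 + 1"
proof -
  have "vertex_transitive (gen_petersen n k)"
    by (rule is_cayley_graph_imp_vertex_transitive[OF wf_gen_petersen cayley])
  then obtain f where f: "adjacency_iso (gen_petersen n k) (gen_petersen n k) f"
    and "f (vert n False 0) = vert n True 0"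
    using vert_in_verts[OF n] unfolding vertex_transitive_def by blast
  from adjacency_iso_strides_cong[OF n g g this] show ?thesis
    by (simp add: stride_def power2_eq_square)
qed

lemma multigraph_iso_gen_petersen_even_imp_eq:
  assumes n: "n > 0" "even n" and k: "even k" "2 * k \<le> n" "generic 8 n k"
    and l: "2 * l \<le> m" "generic 8 m l"
    and iso: "multigraph_iso (gen_petersen n k) (gen_petersen m l)"
  shows "n = m \<and> k = l"
proof -
  have m: "n = m" by (rule multigraph_iso_gen_petersen_imp_eq_order[OF iso])
  have "even z" if "int n dvd z" for z
    using n(2) that by (meson dvd_trans even_of_nat)
  then have "\<not> int n dvd int l * int k - 1" "\<not> int n dvd int l * int k + 1"
    using k(1) by fastforce+
  then consider "int n dvd int k - int l" | "int n dvd int k + int l"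
    using multigraph_iso_gen_petersen_cong[OF n(1) k(3)] l(2) iso unfolding m by blast
  then have "k = l"
  proof cases
    case 1
    then have "int k mod int n = int l mod int n" by (simp add: mod_eq_dvd_iff)
    then show ?thesis using k(2) l(1) n(1) m by simp
  next
    case 2
    then have "n dvd k + l" by (simp flip: of_nat_add)
    then have "k + l = 0 \<or> n \<le> k + l" using dvd_imp_le by blast
    then show ?thesis using k(2) l(1) m by auto
  qed
  then show ?thesis using m by simp
qed

section \<open>Counting square roots and non-generic strides\<close>

lemma card_divisors_le:
  fixes n :: nat
  assumes n: "n > 0"
  shows "real (card {d. d dvd n}) \<le> 2 * sqrt (real n)"
proof -
  define r where "r = nat \<lfloor>sqrt (real n)\<rfloor>"
  have r: "real r \<le> sqrt (real n)" "sqrt (real n) < real r + 1"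
    by (simp_all add: r_def)
  have "{d. d dvd n} \<subseteq> {1..r} \<union> (\<lambda>d. n div d) ` {1..r}"
  proof
    fix d assume "d \<in> {d. d dvd n}"
    then obtain e where e: "n = d * e" by auto
    then have pos: "d > 0" "e > 0" using n by auto
    have "d \<le> r \<or> e \<le> r"
    proof (rule ccontr)
      assume "\<not> ?thesis"
      then have "sqrt (real n) < real d" "sqrt (real n) < real e" using r by linarith+
      then have "sqrt (real n) * sqrt (real n) < real d * real e"
        using pos by (intro mult_strict_mono) auto
      then show False using e by simp
    qed
    moreover have "d = n div e" using e pos by simp
    ultimately show "d \<in> {1..r} \<union> (\<lambda>d. n div d) ` {1..r}"
      using pos by force
  qed
  then have "card {d. d dvd n} \<le> card ({1..r} \<union> (\<lambda>d. n div d) ` {1..r})"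
    by (rule card_mono[rotated]) simp
  also have "\<dots> \<le> r + r"
    using card_Un_le[of "{1..r}" "(\<lambda>d. n div d) ` {1..r}"] card_image_le[of "{1..r}" "\<lambda>d. n div d"]
    by simp
  finally show ?thesis using r(1) by linarith
qed

lemma sqrt_mod_cofactor_dvd_add:
  fixes n c d e x y :: int
  assumes x: "n dvd x\<^sup>2 - c" and y: "n dvd y\<^sup>2 - c"
    and n: "n = d * e" "n \<noteq> 0" and d: "gcd n (x - y) = d"
  shows "e dvd x + y"
proof -
  have "x\<^sup>2 - c - (y\<^sup>2 - c) = (x - y) * (x + y)" by (simp add: power2_eq_square algebra_simps)
  then have "n dvd (x - y) * (x + y)" using dvd_diff[OF x y] by simp
  then have "n dvd gcd (n * (x + y)) ((x - y) * (x + y))" by simp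
  then have "n dvd d * (x + y)" unfolding d[symmetric] by (simp add: gcd_mult_right ac_simps)
  then show ?thesis using n by simp
qed

lemma sqrt_mod_determined_by_gcd:
  fixes n c k k' k0 :: int
  assumes n: "n \<noteq> 0" and c: "coprime n c"
    and k: "n dvd k\<^sup>2 - c" and k': "n dvd k'\<^sup>2 - c" and k0: "n dvd k0\<^sup>2 - c"
    and eq: "gcd n (k - k0) = gcd n (k' - k0)"
  shows "n dvd 2 * (k - k')"
proof -
  define d where "d = gcd n (k - k0)"
  obtain e where e: "n = d * e" by (metis d_def dvdE gcd_dvd1)
  have cofactor: "e dvd k + k0" "e dvd k' + k0"
    using sqrt_mod_cofactor_dvd_add[OF k k0 e n] sqrt_mod_cofactor_dvd_add[OF k' k0 e n] eq
    by (simp_all add: d_def)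
  have d: "d dvd k - k0" "d dvd k' - k0" by (simp add: d_def) (simp add: d_def eq)
  have "e dvd k - k'" "d dvd k - k'"
    using dvd_diff[OF cofactor] dvd_diff[OF d] by simp_all
  then have lcm: "lcm d e dvd k - k'" by (rule lcm_least[rotated])
  define g where "g = gcd d e"
  have "g dvd (k + k0) - (k - k0)"
    unfolding g_def using cofactor(1) d(1) by (meson dvd_diff dvd_trans gcd_dvd1 gcd_dvd2)
  then have "g dvd 2 * k0 * k0" by simp
  moreover have "g dvd n" unfolding g_def e by simp
  then have "g dvd 2 * (k0\<^sup>2 - c)" using k0 by (meson dvd_mult dvd_trans)
  ultimately have "g dvd 2 * k0 * k0 - 2 * (k0\<^sup>2 - c)" by (rule dvd_diff)
  then have "g dvd 2 * c" by (simp add: power2_eq_square algebra_simps)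
  moreover have "coprime g c" using c \<open>g dvd n\<close> by (rule coprime_divisors[OF _ dvd_refl, rotated])
  ultimately have "g dvd 2" by (simp add: coprime_dvd_mult_left_iff)
  then have "g * lcm d e dvd 2 * (k - k')" using lcm by (rule mult_dvd_mono)
  then show ?thesis by (simp add: g_def e flip: abs_mult)
qed

lemma card_sqrt_mod_le:
  assumes n: "n > 0" and c: "coprime (int n) c"
  shows "card {k \<in> {1..n div 2}. int n dvd (int k)\<^sup>2 - c} \<le> card {d. d dvd n}" (is "card ?S \<le> _")
proof (cases "?S = {}")
  case False
  then obtain k0 where k0: "int n dvd (int k0)\<^sup>2 - c" by blast
  define \<phi> where "\<phi> k = nat (gcd (int n) (int k - int k0))" for k
  have "inj_on \<phi> ?S"
  proof
    fix k k' assume k: "k \<in> ?S" and k': "k' \<in> ?S" and "\<phi> k = \<phi> k'"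
    then have "gcd (int n) (int k - int k0) = gcd (int n) (int k' - int k0)"
      unfolding \<phi>_def by (metis gcd_ge_0_int nat_0_le)
    then have "int n dvd 2 * (int k - int k')"
      using sqrt_mod_determined_by_gcd[OF _ c _ _ k0] k k' n by simp
    moreover have "\<bar>2 * (int k - int k')\<bar> < int n" using k k' by auto
    ultimately have "2 * (int k - int k') = 0" by (metis abs_of_nat dvd_imp_le_int not_le)
    then show "k = k'" by simp
  qed
  moreover have "\<phi> ` ?S \<subseteq> {d. d dvd n}" by (auto simp: \<phi>_def nat_dvd_iff)
  moreover have "finite {d. d dvd n}" using n by simp
  ultimately show ?thesis by (rule card_inj_on_le)
next
  case True
  show ?thesis unfolding True by simp
qed

lemma not_generic_relation:
  assumes n: "r < n" and k: "1 \<le> k" "2 * k \<le> n" and not_generic: "\<not> generic r n k"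
  obtains x y t where "{x, y, t} \<subseteq> {- int r..int r}" "y \<noteq> 0" "x + y * int k = int n * t"
proof -
  obtain x y where x: "\<bar>x\<bar> \<le> int r" and y: "\<bar>y\<bar> \<le> int r" and "int n dvd x + y * int k"
      and nontrivial: "\<not> (x = 0 \<and> y = 0)"
    using not_generic unfolding generic_def by blast
  then obtain t where t: "x + y * int k = int n * t" by blast
  have "y \<noteq> 0"
  proof
    assume "y = 0"
    then have "int n \<le> \<bar>x\<bar>" using t nontrivial dvd_imp_le_int[of x "int n"] by simp
    then show False using x n by linarith
  qed
  moreover have "\<bar>t\<bar> \<le> int r"
  proof -
    have "\<bar>y\<bar> * (2 * int k) \<le> int r * int n" using y k(2) by (intro mult_mono) auto
    moreover have "int r * 2 \<le> int r * int n" using k by (intro mult_left_mono) auto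
    moreover have "\<bar>int n * t\<bar> \<le> \<bar>x\<bar> + \<bar>y\<bar> * int k"
      unfolding t[symmetric] by (metis abs_mult abs_of_nat abs_triangle_ineq)
    ultimately have "int n * \<bar>t\<bar> \<le> int n * int r"
      using x by (simp add: abs_mult algebra_simps)
    then show ?thesis using n by simp
  qed
  ultimately show thesis using that[of x y t] x y t by (simp add: abs_le_iff)
qed

lemma card_not_generic_le: "card {k \<in> {1..n div 2}. \<not> generic r n k} \<le> (2 * r + 1) ^ 3"
  (is "card ?S \<le> _")
proof (cases "n \<le> r")
  case True
  have "card ?S \<le> card {1..n div 2}" by (rule card_mono) auto
  also have "\<dots> \<le> 2 * r + 1" using True by simp
  also have "\<dots> \<le> (2 * r + 1) ^ 3" by (rule self_le_power) simp_all
  finally show ?thesis .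
next
  case False
  define I where "I = {- int r..int r}"
  have "?S \<subseteq> (\<lambda>(x, y, t). nat ((int n * t - x) div y)) ` (I \<times> I \<times> I)"
  proof
    fix k assume "k \<in> ?S"
    then have "r < n" "1 \<le> k" "2 * k \<le> n" "\<not> generic r n k" using False by auto
    then obtain x y t where "{x, y, t} \<subseteq> I" "y \<noteq> 0" and t: "x + y * int k = int n * t"
      unfolding I_def by (rule not_generic_relation)
    moreover from \<open>y \<noteq> 0\<close> have "k = nat ((int n * t - x) div y)" by (simp flip: t)
    ultimately show "k \<in> (\<lambda>(x, y, t). nat ((int n * t - x) div y)) ` (I \<times> I \<times> I)"
      by (intro image_eqI[of _ _ "(x, y, t)"]) simp_all
  qed
  then have "card ?S \<le> card (I \<times> I \<times> I)" by (rule surj_card_le[rotated]) (simp add: I_def)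
  also have "card I = 2 * r + 1" by (simp add: I_def)
  then have "card (I \<times> I \<times> I) = (2 * r + 1) ^ 3"
    by (simp only: card_cartesian_product power3_eq_cube mult.assoc)
  finally show ?thesis .
qed

lemma card_cayley_le:
  assumes n: "n > 0"
  shows "real (card {k \<in> {1..n div 2}. is_cayley_graph (gen_petersen n k)})
    \<le> 5000 + 4 * sqrt (real n)"
    (is "real (card ?S) \<le> _")
proof -
  let ?G = "{k \<in> {1..n div 2}. \<not> generic 8 n k}"
  let ?Q = "\<lambda>c. {k \<in> {1..n div 2}. int n dvd (int k)\<^sup>2 - c}"
  have "?S \<subseteq> ?G \<union> (?Q 1 \<union> ?Q (- 1))"
    using cayley_gen_petersen_cong[OF n] by auto
  then have "card ?S \<le> card (?G \<union> (?Q 1 \<union> ?Q (- 1)))"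
    by (rule card_mono[rotated]) simp
  also have "\<dots> \<le> card ?G + (card (?Q 1) + card (?Q (- 1)))"
    by (meson add_left_mono card_Un_le le_trans)
  also have "\<dots> \<le> (2 * 8 + 1) ^ 3 + (card {d. d dvd n} + card {d. d dvd n})"
    by (intro add_mono card_not_generic_le card_sqrt_mod_le n) simp_all
  finally have "card ?S \<le> 5000 + 2 * card {d. d dvd n}" by simp
  then show ?thesis using card_divisors_le[OF n] by linarith
qed

section \<open>Counting isomorphism classes\<close>

lemma num_iso_classes_le_card:
  assumes "finite \<X>"
  shows "num_iso_classes \<X> \<le> card \<X>"
  unfolding num_iso_classes_def quotient_def UNION_singleton_eq_range
  by (rule card_image_le[OF assms])

lemma card_le_num_iso_classes:
  assumes fin: "finite \<X>" and sub: "F ` I \<subseteq> \<X>"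
    and non_iso: "\<And>i j. i \<in> I \<Longrightarrow> j \<in> I \<Longrightarrow> multigraph_iso (F i) (F j) \<Longrightarrow> i = j"
  shows "card I \<le> num_iso_classes \<X>"
proof -
  let ?r = "{(X, Y). X \<in> \<X> \<and> Y \<in> \<X> \<and> multigraph_iso X Y}"
  have "inj_on (\<lambda>i. ?r `` {F i}) I"
  proof
    fix i j assume ij: "i \<in> I" "j \<in> I" and eq: "?r `` {F i} = ?r `` {F j}"
    have "F j \<in> ?r `` {F i}" unfolding eq using ij sub by (auto simp: multigraph_iso_refl)
    then have "multigraph_iso (F i) (F j)" by simp
    then show "i = j" by (rule non_iso[OF ij])
  qed
  moreover have "(\<lambda>i. ?r `` {F i}) ` I \<subseteq> \<X> // ?r"
    using sub by (intro image_subsetI quotientI) blast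
  moreover have "finite (\<X> // ?r)" by (rule finite_quotient[OF fin]) auto
  ultimately show ?thesis unfolding num_iso_classes_def by (rule card_inj_on_le)
qed

lemma num_cayley_gen_petersen_le:
  "real (num_cayley_gen_petersen N) \<le> real N * (5000 + 4 * sqrt (real N))"
proof -
  let ?X = "{X \<in> gen_petersen_upto N. is_cayley_graph X}"
  let ?K = "\<lambda>n. {k \<in> {1..n div 2}. is_cayley_graph (gen_petersen n k)}"
  have "num_cayley_gen_petersen N \<le> card ?X"
    unfolding num_cayley_gen_petersen_def
    by (rule num_iso_classes_le_card) (simp add: finite_gen_petersen_upto)
  also have "\<dots> \<le> card (SIGMA n:{1..N}. ?K n)"
  proof (rule surj_card_le)
    show "?X \<subseteq> (\<lambda>(n, k). gen_petersen n k) ` (SIGMA n:{1..N}. ?K n)"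
    proof
      fix X assume "X \<in> ?X"
      then obtain n k where "X = gen_petersen n k" "(n, k) \<in> (SIGMA n:{1..N}. ?K n)"
        by (auto simp: gen_petersen_upto_def)
      then show "X \<in> (\<lambda>(n, k). gen_petersen n k) ` (SIGMA n:{1..N}. ?K n)"
        by (intro image_eqI[of _ _ "(n, k)"]) simp_all
    qed
  qed simp
  also have "\<dots> = (\<Sum>n=1..N. card (?K n))" by simp
  finally have "real (num_cayley_gen_petersen N) \<le> (\<Sum>n=1..N. real (card (?K n)))"
    by (simp flip: of_nat_sum)
  also have "\<dots> \<le> (\<Sum>n=1..N. 5000 + 4 * sqrt (real N))"
  proof (rule sum_mono)
    fix n assume n: "n \<in> {1..N}"
    then have "real (card (?K n)) \<le> 5000 + 4 * sqrt (real n)" using card_cayley_le[of n] by simp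
    also have "\<dots> \<le> 5000 + 4 * sqrt (real N)" using n by simp
    finally show "real (card (?K n)) \<le> 5000 + 4 * sqrt (real N)" .
  qed
  finally show ?thesis by simp
qed

lemma card_generic_even_ge:
  "real m / 2 - 4914 \<le> real (card {j \<in> {1..m div 2}. generic 8 (2 * m) (2 * j)})"
  (is "_ \<le> real (card ?J)")
proof -
  let ?B = "{j \<in> {1..m div 2}. \<not> generic 8 (2 * m) (2 * j)}"
  have "card ?B \<le> card {k \<in> {1..2 * m div 2}. \<not> generic 8 (2 * m) k}"
    by (rule card_inj_on_le[of "\<lambda>j. 2 * j"]) (auto simp: inj_on_def)
  also have "\<dots> \<le> (2 * 8 + 1) ^ 3" by (rule card_not_generic_le)
  finally have "card ?B \<le> 4913" by simp
  moreover have "card (?J \<union> ?B) = card ?J + card ?B" by (rule card_Un_disjoint) auto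
  moreover have "?J \<union> ?B = {1..m div 2}" by auto
  ultimately show ?thesis by simp
qed

definition generic_even_pairs :: "nat \<Rightarrow> (nat \<times> nat) set" where
  "generic_even_pairs M = (SIGMA m:{1..M}. {j \<in> {1..m div 2}. generic 8 (2 * m) (2 * j)})"

lemma card_generic_even_pairs_ge:
  "real M * (real M + 1) / 4 - 4914 * real M \<le> real (card (generic_even_pairs M))"
proof -
  let ?J = "\<lambda>m. {j \<in> {1..m div 2}. generic 8 (2 * m) (2 * j)}"
  have "real M * (real M + 1) / 4 - 4914 * real M = (\<Sum>m=1..M. real m / 2 - 4914)"
    using double_gauss_sum_from_Suc_0[of M, where ?'a = real]
    by (simp add: sum_subtractf flip: sum_divide_distrib)
  also have "\<dots> \<le> (\<Sum>m=1..M. real (card (?J m)))"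
    by (intro sum_mono card_generic_even_ge)
  also have "\<dots> = real (card (generic_even_pairs M))" by (simp add: generic_even_pairs_def)
  finally show ?thesis .
qed

lemma card_generic_even_pairs_le:
  "card (generic_even_pairs (N div 2)) \<le> num_gen_petersen N"
  unfolding num_gen_petersen_def
proof (rule card_le_num_iso_classes[OF finite_gen_petersen_upto])
  let ?F = "\<lambda>(m, j). gen_petersen (2 * m) (2 * j)"
  show "?F ` generic_even_pairs (N div 2) \<subseteq> gen_petersen_upto N"
  proof
    fix X assume "X \<in> ?F ` generic_even_pairs (N div 2)"
    then obtain m j where "(m, j) \<in> generic_even_pairs (N div 2)"
        and X: "X = gen_petersen (2 * m) (2 * j)"
      by auto
    then have "3 \<le> 2 * m" "2 * m \<le> N" "1 \<le> 2 * j" "2 * (2 * j) \<le> 2 * m"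
      by (auto simp: generic_even_pairs_def)
    then show "X \<in> gen_petersen_upto N"
      unfolding gen_petersen_upto_def X by blast
  qed
  show "a = b" if "a \<in> generic_even_pairs (N div 2)" "b \<in> generic_even_pairs (N div 2)"
      "multigraph_iso (?F a) (?F b)" for a b
  proof (cases a, cases b)
    fix m j m' j' assume "a = (m, j)" "b = (m', j')"
    then show ?thesis
      using multigraph_iso_gen_petersen_even_imp_eq[of "2 * m" "2 * j" "2 * j'" "2 * m'"] that
      by (auto simp: generic_even_pairs_def)
  qed
qed

lemma num_gen_petersen_ge: "(real N)\<^sup>2 / 16 - 5000 * real N \<le> real (num_gen_petersen N)"
proof (cases "N = 0")
  case False
  define M where "M = N div 2"
  have M: "2 * M \<le> N" "N \<le> 2 * M + 1" by (auto simp: M_def)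
  then have "(real N)\<^sup>2 \<le> (2 * real M + 1)\<^sup>2" by (intro power_mono) linarith+
  also have "\<dots> = 4 * (real M * (real M + 1)) + 1" by (simp add: power2_eq_square algebra_simps)
  finally have "(real N)\<^sup>2 / 16 - 5000 * real N \<le> real M * (real M + 1) / 4 - 4914 * real M"
    using M(1) False by linarith
  also have "\<dots> \<le> real (card (generic_even_pairs M))" by (rule card_generic_even_pairs_ge)
  also have "\<dots> \<le> real (num_gen_petersen N)"
    unfolding M_def using card_generic_even_pairs_le by simp
  finally show ?thesis .
qed simp

theorem theorem1p3:
  "(\<lambda>N. real (num_cayley_gen_petersen N) / real (num_gen_petersen N)) \<longlonglongrightarrow> 0"
proof (rule tendsto_sandwich[OF _ _ tendsto_const])
  let ?bound = "\<lambda>N :: nat. real N * (5000 + 4 * sqrt (real N)) / ((real N)\<^sup>2 / 16 - 5000 * real N)"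
  show "\<forall>\<^sub>F N in sequentially. 0 \<le> real (num_cayley_gen_petersen N) / real (num_gen_petersen N)"
    by simp
  show "\<forall>\<^sub>F N in sequentially.
      real (num_cayley_gen_petersen N) / real (num_gen_petersen N) \<le> ?bound N"
    using eventually_gt_at_top[of 80000]
  proof eventually_elim
    case (elim N)
    then have "80000 * real N < real N * real N" by (intro mult_strict_right_mono) auto
    then have "0 < (real N)\<^sup>2 / 16 - 5000 * real N" by (simp add: power2_eq_square)
    then show ?case
      by (intro frac_le num_cayley_gen_petersen_le num_gen_petersen_ge) auto
  qed
  show "?bound \<longlonglongrightarrow> 0" by real_asymp
qed

end
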